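(* Let $\mathbb{V}$ be a vector space of finite dimension $n>1$ over a field $\mathbb{F}$. Let $\{\alpha_1,\alpha_2,\ldots,\alpha_n\}$ be a basis of $\mathbb{V}$ and, for $i=1,2,\ldots,n$, let $W_i=\langle \alpha_1,\ldots,\alpha_{i-1},\alpha_{i+1},\ldots,\alpha_n\rangle$. Then the collection $\mathcal{W}=\{W_i : 1\leq i\leq n\}$ is a minimum dominating set in the subspace sum graph $\mathcal{G}(\mathbb{V})$, and hence $\gamma(\mathcal{G}(\mathbb{V}))=n$.
   Context: For a finite dimensional vector space $\mathbb{V}$ over a field $\mathbb{F}$ with $\dim(\mathbb{V})>1$, the subspace sum graph $\mathcal{G}(\mathbb{V})$ is the graph whose vertices are the non-trivial proper subspaces of $\mathbb{V}$ (subspaces $W$ with $W\neq\{0\}$ and $W\neq\mathbb{V}$), two vertices $W_1,W_2$ being adjacent if and only if $W_1+W_2=\mathbb{V}$. A dominating set of a graph with vertex set $V$ is a subset $D\subseteq V$ such that every vertex in $V\setminus D$ is adjacent to at least one vertex in $D$. The domination number $\gamma(G)$ is the minimum size of a dominating set; a minimum dominating set is one of minimum size. $\langle\cdot\rangle$ denotes linear span.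
   Formalization: For n = 2 the graph is complete (any two distinct lines sum to the whole space), so one vertex dominates and γ = 1; the claims that 𝒲 is minimum and that γ = n are therefore made only for n ≥ 3, while 𝒲 is shown to be dominating for all n > 1. *)

theory Defs
  imports Complex_Main "HOL-Library.Set_Algebras" "HOL-Library.Equipollence"
    "HOL-Library.Extended_Nat"
begin

record 'a ugraph =
  verts :: "'a set"
  adj :: "'a \<Rightarrow> 'a \<Rightarrow> bool"

definition dominating_set :: "'a ugraph \<Rightarrow> 'a set \<Rightarrow> bool" where
  "dominating_set G D \<longleftrightarrow>
     D \<subseteq> verts G \<and> (\<forall>v \<in> verts G - D. \<exists>u \<in> D. adj G v u)"

(* Over an infinite field the subspace sum graph is infinite, so sizes are compared by
   injections: card would make every infinite set have size 0. *)
definition minimum_dominating_set :: "'a ugraph \<Rightarrow> 'a set \<Rightarrow> bool" where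
  "minimum_dominating_set G D \<longleftrightarrow>
     dominating_set G D \<and> (\<forall>D'. dominating_set G D' \<longrightarrow> D \<lesssim> D')"

(* For the same reason infinite dominating sets count as having size infinity. *)
definition domination_number :: "'a ugraph \<Rightarrow> enat" where
  "domination_number G =
     (INF D \<in> {D. dominating_set G D}. if finite D then enat (card D) else \<infinity>)"

(* The ambient space is the whole type 'v; the plus on sets is the pointwise sum
   from Set_Algebras. Adjacency is irreflexive on the vertices since these are proper. *)
definition subspace_sum_graph ::
    "('f::field \<Rightarrow> 'v::ab_group_add \<Rightarrow> 'v) \<Rightarrow> 'v set ugraph" where
  "subspace_sum_graph scale =
     \<lparr>verts = {W. module.subspace scale W \<and> W \<noteq> {0} \<and> W \<noteq> UNIV},
      adj = (\<lambda>W1 W2. W1 + W2 = UNIV)\<rparr>"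

definition basis_hyperplane ::
    "('f::field \<Rightarrow> 'v::ab_group_add \<Rightarrow> 'v) \<Rightarrow> nat \<Rightarrow> (nat \<Rightarrow> 'v) \<Rightarrow> nat \<Rightarrow> 'v set" where
  "basis_hyperplane scale n \<alpha> i = module.span scale (\<alpha> ` ({1..n} - {i}))"

definition basis_hyperplanes ::
    "('f::field \<Rightarrow> 'v::ab_group_add \<Rightarrow> 'v) \<Rightarrow> nat \<Rightarrow> (nat \<Rightarrow> 'v) \<Rightarrow> 'v set set" where
  "basis_hyperplanes scale n \<alpha> = basis_hyperplane scale n \<alpha> ` {1..n}"

(* In dimension 2 the subspace sum graph is complete, so one vertex dominates and the
   family of basis hyperplanes, although dominating, is not minimum. *)
lemma dim2_not_minimum:
  fixes scale :: "'f::field \<Rightarrow> 'v::ab_group_add \<Rightarrow> 'v" and \<alpha> :: "nat \<Rightarrow> 'v"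
  assumes V: "vector_space scale"
    and inj: "inj_on \<alpha> {1..2}"
    and indep: "\<not> module.dependent scale (\<alpha> ` {1..2})"
    and span: "module.span scale (\<alpha> ` {1..2}) = UNIV"
  shows "\<not> minimum_dominating_set (subspace_sum_graph scale) (basis_hyperplanes scale 2 \<alpha>)"
    and "domination_number (subspace_sum_graph scale) = 1"
proof -
  interpret vector_space scale by (rule V)
  let ?G = "subspace_sum_graph scale"
  define a b where "a = \<alpha> 1" and "b = \<alpha> 2"
  have I: "{1..2::nat} = {1, 2}" by auto
  have im: "\<alpha> ` {1..2} = {a, b}" unfolding I a_def b_def by simp
  have ab: "a \<noteq> b" using inj unfolding I a_def b_def by (auto simp: inj_on_def)
  have indab: "independent {a, b}" and spab: "span {a, b} = UNIV"
    using indep span im by auto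
  have a_b: "a \<notin> span {b}" and b_a: "b \<notin> span {a}"
    using indab ab by (auto simp: dependent_def insert_Diff_if)
  have b0: "b \<noteq> 0" using b_a span_zero by metis
  have H1: "basis_hyperplane scale 2 \<alpha> 1 = span {b}"
  proof -
    have "{1..2::nat} - {1} = {2}" by auto
    then show ?thesis by (simp add: basis_hyperplane_def b_def)
  qed
  have H2: "basis_hyperplane scale 2 \<alpha> 2 = span {a}"
  proof -
    have "{1..2::nat} - {2} = {1}" by auto
    then show ?thesis by (simp add: basis_hyperplane_def a_def)
  qed
  have W: "basis_hyperplanes scale 2 \<alpha> = {span {b}, span {a}}"
    unfolding basis_hyperplanes_def I using H1 H2 by simp
  have dom: "dominating_set ?G {span {b}}"
  proof -
    have "span {b} \<noteq> {0}" using b0 span_base[of b "{b}"] by auto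
    moreover have "span {b} \<noteq> UNIV" using a_b by auto
    moreover have "U + span {b} = UNIV"
      if U: "subspace U" "U \<noteq> {0}" "U \<noteq> span {b}" for U
    proof -
      have "\<exists>u \<in> U. u \<notin> span {b}"
      proof (rule ccontr)
        assume "\<not> ?thesis"
        then have sub: "U \<subseteq> span {b}" by auto
        obtain u where u: "u \<in> U" "u \<noteq> 0" using U(1,2) subspace_0 by blast
        then obtain k where k: "u = scale k b" using sub by (auto simp: span_singleton)
        then have "k \<noteq> 0" using u by auto
        then have "b = scale (inverse k) u" using k by simp
        then have "b \<in> U" using subspace_scale[OF U(1) u(1)] by metis
        then have "span {b} \<subseteq> U" using U(1) by (simp add: span_minimal)
        then show False using sub U(3) by auto
      qed
      then obtain u where u: "u \<in> U" "u \<notin> span {b}" by blast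
      have "u \<in> span {a, b}" using spab by auto
      then have "a \<in> span {u, b}"
        using u(2) in_span_insert by metis
      then have "{a, b} \<subseteq> span {u, b}" by (simp add: span_base)
      then have full: "span {u, b} = UNIV"
        using spab span_minimal[OF _ subspace_span] by (metis top.extremum_unique)
      show ?thesis
      proof (intro set_eqI iffI UNIV_I)
        fix x
        have "x \<in> span (insert u {b})" using full by auto
        then obtain k where k: "x - scale k u \<in> span {b}"
          by (auto simp: span_breakdown_eq)
        have "scale k u \<in> U" using subspace_scale[OF U(1) u(1)] .
        then have "scale k u + (x - scale k u) \<in> U + span {b}" using k
          by (rule set_plus_intro)
        then show "x \<in> U + span {b}" by simp
      qed
    qed
    ultimately show ?thesis
      by (auto simp: dominating_set_def subspace_sum_graph_def)
  qed
  have "span {b} \<noteq> span {a}" using a_b span_base[of a "{a}"] by auto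
  then have "\<not> {span {b}, span {a}} \<lesssim> {span {b}}"
    by (auto simp: lepoll_def inj_on_def)
  with dom show "\<not> minimum_dominating_set ?G (basis_hyperplanes scale 2 \<alpha>)"
    unfolding W minimum_dominating_set_def by blast
  show "domination_number ?G = 1"
  proof (rule antisym)
    have "domination_number ?G \<le> (if finite {span {b}} then enat (card {span {b}}) else \<infinity>)"
      unfolding domination_number_def using dom by (intro INF_lower) simp
    then show "domination_number ?G \<le> 1" by (simp add: one_enat_def)
    have "card D \<ge> 1" if D: "dominating_set ?G D" "finite D" for D
    proof -
      have "span {b} \<in> verts ?G" using dom by (simp add: dominating_set_def)
      then have "D \<noteq> {}" using D by (auto simp: dominating_set_def)
      then show ?thesis using D(2) by (simp add: Suc_le_eq card_gt_0_iff)
    qed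
    then show "1 \<le> domination_number ?G"
      unfolding domination_number_def by (intro INF_greatest) (auto simp: one_enat_def)
  qed
qed

end

theory Submission
  imports Defs
begin

text \<open>
  A line \<open>\<langle>w\<rangle>\<close> is hard to dominate: a proper subspace \<open>U\<close> with \<open>\<langle>w\<rangle> + U\<close> equal to the whole space is a
  hyperplane that does not contain \<open>w\<close>.

  \<^emph>\<open>The basis hyperplanes dominate\<close>, because a nonzero vector has a nonzero coordinate: it lies
  outside some \<open>W\<^sub>i\<close>, and a hyperplane together with a vector outside it spans everything.

  \<^emph>\<open>Fewer than \<open>n\<close> subspaces do not dominate\<close> when \<open>n > 2\<close>. Let \<open>D\<close> be a set of fewer than \<open>n\<close>
  vertices. If each member is enlarged to a hyperplane, these hyperplanes have a nonzero vector
  \<open>w\<close> in common, and no member of \<open>D\<close> is adjacent to \<open>\<langle>w\<rangle>\<close>. The difficulty is that \<open>\<langle>w\<rangle>\<close> may itself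
  belong to \<open>D\<close>, and a vertex of a dominating set need not be adjacent to another one. The lines
  in \<open>D\<close> are therefore treated separately. Let \<open>L\<close> be the set of lines in \<open>D\<close> and \<open>M\<close> the set of
  other members of \<open>D\<close>. The common part \<open>X\<close> of hyperplanes enlarging the members of \<open>M\<close> has
  dimension at least \<open>n - |M| > |L|\<close> (lemma \<open>exists_large_subspace_with_proper_sums\<close>). A basis of
  \<open>X\<close> then has more vectors than there are lines in \<open>L\<close>, and a line contains at most one of
  them, so some basis vector \<open>w\<close> lies on no line of \<open>L\<close>
  (lemma \<open>exists_nonzero_vector_off_lines\<close>). Now \<open>\<langle>w\<rangle>\<close> is a vertex outside \<open>D\<close>. It is not adjacent
  to any member of \<open>M\<close> by the choice of \<open>X\<close>, nor to any line in \<open>L\<close>, since two lines span a space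
  of dimension at most two. This last step is where \<open>n = 2\<close> fails.
\<close>

section \<open>The basis hyperplanes form a dominating set\<close>

context vector_space
begin

lemma plus_span_eq_UNIV:
  assumes U: "subspace U" and u: "u \<in> U" "u \<notin> span S" and full: "span (insert b S) = UNIV"
  shows "U + span S = UNIV"
proof -
  \<comment> \<open>By exchange, \<open>u\<close> can replace \<open>b\<close> in the spanning set.\<close>
  have "b \<in> span (insert u S)"
    using in_span_insert[of u b S] u(2) full by auto
  then have "insert b S \<subseteq> span (insert u S)"
    by (auto intro: span_base)
  then have uS: "span (insert u S) = UNIV"
    using full span_minimal[OF _ subspace_span] by (metis top.extremum_unique)
  have "x \<in> U + span S" for x
  proof -
    obtain k where k: "x - scale k u \<in> span S"
      using uS span_breakdown_eq[of x u S] by auto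
    have "scale k u + (x - scale k u) \<in> U + span S"
      using subspace_scale[OF U u(1)] k by (rule set_plus_intro)
    then show ?thesis by simp
  qed
  then show ?thesis by auto
qed

text \<open>
  A vector lies in the span of \<open>B - {b}\<close> only if its coordinate at \<open>b\<close> vanishes, and only the
  zero vector has no nonzero coordinate.
\<close>

lemma exists_basis_hyperplane_avoiding:
  assumes B: "independent B" "span B = UNIV" and x: "x \<noteq> 0"
  shows "\<exists>b\<in>B. x \<notin> span (B - {b})"
proof (rule ccontr)
  assume "\<not> ?thesis"
  then have inall: "x \<in> span (B - {b})" if "b \<in> B" for b using that by blast
  have zero: "representation B x b = 0" for b
  proof (cases "b \<in> B")
    case True
    have "representation B x = representation (B - {b}) x"
      using B(1) inall[OF True] by (intro representation_extend) auto
    then show ?thesis using representation_ne_zero[of "B - {b}" x b] by auto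
  next
    case False
    then show ?thesis using representation_ne_zero by blast
  qed
  have "(\<Sum>v | representation B x v \<noteq> 0. scale (representation B x v) v) = x"
    using B by (intro sum_nonzero_representation_eq) auto
  then show False using zero x by simp
qed

end

locale indexed_basis = vector_space scale
  for scale :: "'f::field \<Rightarrow> 'v::ab_group_add \<Rightarrow> 'v" +
  fixes n :: nat and \<alpha> :: "nat \<Rightarrow> 'v"
  assumes inj: "inj_on \<alpha> {1..n}"
    and indep: "independent (\<alpha> ` {1..n})"
    and spanning: "span (\<alpha> ` {1..n}) = UNIV"
begin

lemma basis_hyperplane_eq:
  assumes "i \<in> {1..n}"
  shows "basis_hyperplane scale n \<alpha> i = span (\<alpha> ` {1..n} - {\<alpha> i})"
  using inj_on_image_set_diff[OF inj, of "{1..n}" "{i}"] assms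
  by (simp add: basis_hyperplane_def)

lemma basis_vector_notin_hyperplane:
  assumes "i \<in> {1..n}"
  shows "\<alpha> i \<notin> basis_hyperplane scale n \<alpha> i"
  using indep assms by (auto simp: basis_hyperplane_eq dependent_def)

lemma basis_vector_in_other_hyperplane:
  assumes "j \<in> {1..n}" "j \<noteq> i"
  shows "\<alpha> j \<in> basis_hyperplane scale n \<alpha> i"
  using assms by (auto simp: basis_hyperplane_def intro: span_base)

lemma card_basis_hyperplanes: "card (basis_hyperplanes scale n \<alpha>) = n"
proof -
  have "inj_on (basis_hyperplane scale n \<alpha>) {1..n}"
  proof (rule inj_onI, rule ccontr)
    fix i j
    assume ij: "i \<in> {1..n}" "j \<in> {1..n}" "i \<noteq> j"
      and eq: "basis_hyperplane scale n \<alpha> i = basis_hyperplane scale n \<alpha> j"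
    show False
      using basis_vector_notin_hyperplane[OF ij(1)] basis_vector_in_other_hyperplane[OF ij(1,3)] eq
      by blast
  qed
  then show ?thesis by (simp add: basis_hyperplanes_def card_image)
qed

lemma dominating_basis_hyperplanes:
  assumes n: "n > 1"
  shows "dominating_set (subspace_sum_graph scale) (basis_hyperplanes scale n \<alpha>)"
proof -
  have vert: "basis_hyperplane scale n \<alpha> i \<in> verts (subspace_sum_graph scale)"
    if i: "i \<in> {1..n}" for i
  proof -
    \<comment> \<open>With \<open>n > 1\<close> there is another basis vector, which makes the hyperplane nonzero.\<close>
    obtain j where j: "j \<in> {1..n}" "j \<noteq> i"
      using n that[of "if i = 1 then 2 else 1"] by auto
    have "\<alpha> j \<noteq> 0" using indep j(1) dependent_zero by (metis image_eqI)
    then have "basis_hyperplane scale n \<alpha> i \<noteq> {0}"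
      using basis_vector_in_other_hyperplane[OF j] by auto
    then show ?thesis
      using basis_vector_notin_hyperplane[OF i]
      by (auto simp: subspace_sum_graph_def basis_hyperplane_def)
  qed
  have "\<exists>W \<in> basis_hyperplanes scale n \<alpha>. U + W = UNIV"
    if U: "subspace U" "U \<noteq> {0}" for U
  proof -
    obtain x where x: "x \<in> U" "x \<noteq> 0" using U subspace_0 by blast
    obtain i where i: "i \<in> {1..n}" "x \<notin> span (\<alpha> ` {1..n} - {\<alpha> i})"
      using exists_basis_hyperplane_avoiding[OF indep spanning x(2)] by auto
    have "span (insert (\<alpha> i) (\<alpha> ` {1..n} - {\<alpha> i})) = UNIV"
      using spanning i(1) by (simp add: insert_absorb)
    then have "U + basis_hyperplane scale n \<alpha> i = UNIV"
      unfolding basis_hyperplane_eq[OF i(1)] by (rule plus_span_eq_UNIV[OF U(1) x(1) i(2)])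
    then show ?thesis using i(1) by (auto simp: basis_hyperplanes_def)
  qed
  then show ?thesis
    using vert by (auto simp: dominating_set_def subspace_sum_graph_def basis_hyperplanes_def)
qed

end

section \<open>A dominating set has at least as many members as the dimension\<close>

context finite_dimensional_vector_space
begin

lemma dim_plus_Int:
  assumes "subspace S" "subspace T"
  shows "dim (S + T) + dim (S \<inter> T) = dim S + dim T"
proof -
  have "S + T = {x + y |x y. x \<in> S \<and> y \<in> T}"
    by (auto simp: set_plus_def)
  then show ?thesis using dim_sums_Int[OF assms] by simp
qed

lemma proper_subspace_in_hyperplane:
  assumes U: "subspace U" "U \<noteq> UNIV"
  obtains H where "subspace H" "U \<subseteq> H" "H \<noteq> UNIV" "Suc (dim H) = dimension"
proof -
  \<comment> \<open>Extend a basis of \<open>U\<close> to one of the whole space and omit one of the new vectors.\<close>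
  obtain A where A: "A \<subseteq> U" "independent A" "U \<subseteq> span A"
    using basis_exists[of U] by metis
  obtain B where B: "A \<subseteq> B" "independent B" "UNIV \<subseteq> span B"
    using maximal_independent_subset_extend[of A UNIV] A(2) by (metis subset_UNIV)
  have "span A \<subseteq> U" using A(1) U(1) by (simp add: span_minimal)
  then have "A \<noteq> B" using B(3) U(2) by blast
  then obtain b where b: "b \<in> B" "b \<notin> A" using B(1) by blast
  have notin: "b \<notin> span (B - {b})" using B(2) b(1) by (auto simp: dependent_def)
  have "U \<subseteq> span (B - {b})"
    using A(3) span_mono[of A "B - {b}"] B(1) b(2) by blast
  moreover have "Suc (dim (span (B - {b}))) = dimension"
  proof -
    have "card B = dimension"
      using B(2,3) dim_UNIV basis_card_eq_dim[of B UNIV] by (auto simp: dimension_def)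
    moreover have "dim (span (B - {b})) = card (B - {b})"
      using B(2) by (intro dim_span_eq_card_independent) (rule independent_mono, auto)
    moreover have "Suc (card (B - {b})) = card B"
      using finiteI_independent[OF B(2)] b(1) by (rule card_Suc_Diff1)
    ultimately show ?thesis by simp
  qed
  ultimately show thesis using that[of "span (B - {b})"] notin by auto
qed

text \<open>
  The space is an intersection of hyperplanes, one above each member of the family; each
  intersection lowers the dimension by at most one.
\<close>

lemma exists_large_subspace_with_proper_sums:
  assumes "finite M" and "\<And>U. U \<in> M \<Longrightarrow> subspace U \<and> U \<noteq> UNIV"
  shows "\<exists>X. subspace X \<and> dimension \<le> dim X + card M \<and> (\<forall>U\<in>M. X + U \<noteq> UNIV)"
  using assms
proof (induction M rule: finite_induct)
  case empty
  then show ?case by (intro exI[of _ UNIV]) (simp add: dimension_def)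
next
  case (insert U M)
  obtain X where X: "subspace X" "dimension \<le> dim X + card M" "\<forall>U\<in>M. X + U \<noteq> UNIV"
    using insert.IH insert.prems by blast
  obtain H where H: "subspace H" "U \<subseteq> H" "H \<noteq> UNIV" "Suc (dim H) = dimension"
    using proper_subspace_in_hyperplane[of U] insert.prems[of U] by auto
  have "dim X + dim H \<le> dimension + dim (X \<inter> H)"
    using dim_plus_Int[OF X(1) H(1)] dim_subset_UNIV[of "X + H"] by linarith
  then have "dimension \<le> dim (X \<inter> H) + card (insert U M)"
    using X(2) H(4) insert.hyps by simp
  moreover have "X \<inter> H + W \<noteq> UNIV" if "W \<in> insert U M" for W
  proof (cases "W = U")
    case True
    then have "X \<inter> H + W \<subseteq> H"
      using H(1,2) by (auto elim!: set_plus_elim intro: subspace_add)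
    then show ?thesis using H(3) by blast
  next
    case False
    then have "X + W \<noteq> UNIV" using that X(3) by blast
    moreover have "X \<inter> H + W \<subseteq> X + W" by (intro set_plus_mono2) auto
    ultimately show ?thesis by blast
  qed
  ultimately show ?case using subspace_inter[OF X(1) H(1)] by blast
qed

text \<open>
  A pigeonhole argument on a basis of \<open>X\<close>, valid over every field: over a finite field, \<open>X\<close> can
  be covered by finitely many lines, so their number matters.
\<close>

lemma exists_nonzero_vector_off_lines:
  assumes "finite L" and lines: "\<And>U. U \<in> L \<Longrightarrow> dim U \<le> 1" and less: "card L < dim X"
  shows "\<exists>w\<in>X. w \<noteq> 0 \<and> w \<notin> \<Union>L"
proof -
  obtain B where B: "B \<subseteq> X" "independent B" "card B = dim X"
    using basis_exists[of X] by metis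
  have "0 \<notin> B" using B(2) dependent_zero by auto
  have "\<exists>b\<in>B. b \<notin> \<Union>L"
  proof (rule ccontr)
    assume "\<not> ?thesis"
    then have "\<forall>b\<in>B. \<exists>U. U \<in> L \<and> b \<in> U" by blast
    then obtain f where f: "\<And>b. b \<in> B \<Longrightarrow> f b \<in> L" "\<And>b. b \<in> B \<Longrightarrow> b \<in> f b"
      by metis
    have "inj_on f B"
    proof (rule inj_onI, rule ccontr)
      fix b c assume bc: "b \<in> B" "c \<in> B" "f b = f c" "b \<noteq> c"
      have "independent {b, c}" using bc(1,2) by (intro independent_mono[OF B(2)]) auto
      then have "card {b, c} \<le> dim (f b)"
        using f(2)[OF bc(1)] f(2)[OF bc(2)] bc(3) by (intro independent_card_le_dim) auto
      then show False using lines[OF f(1)[OF bc(1)]] bc(4) by simp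
    qed
    then have "card B \<le> card L"
      using f(1) \<open>finite L\<close> by (intro card_inj_on_le[of f]) auto
    then show False using less B(3) by simp
  qed
  then show ?thesis using B(1) \<open>0 \<notin> B\<close> by (metis subsetD)
qed

lemma dimension_le_card_dominating_set:
  assumes D: "dominating_set (subspace_sum_graph scale) D" "finite D" and dim3: "dimension > 2"
  shows "dimension \<le> card D"
proof (rule ccontr)
  assume "\<not> ?thesis"
  then have less: "card D < dimension" by simp
  have vert: "subspace U" "U \<noteq> UNIV" if "U \<in> D" for U
    using D(1) that by (auto simp: dominating_set_def subspace_sum_graph_def)
  define L where "L = {U \<in> D. dim U \<le> 1}"
  define M where "M = D - L"
  have card: "card D = card L + card M"
    using D(2) card_Diff_subset[of L D] card_mono[of D L]
    by (auto simp: L_def M_def finite_subset)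
  obtain X where X: "subspace X" "dimension \<le> dim X + card M" "\<forall>U\<in>M. X + U \<noteq> UNIV"
    using exists_large_subspace_with_proper_sums[of M] D(2) vert by (auto simp: M_def)
  have "card L < dim X" using X(2) card less by linarith
  then obtain w where w: "w \<in> X" "w \<noteq> 0" "w \<notin> \<Union>L"
    using exists_nonzero_vector_off_lines[of L X] D(2) by (auto simp: L_def)
  have dim1: "dim (span {w}) = 1" using w(2) by simp
  have wD: "span {w} \<notin> D"
    using w(3) dim1 span_base[of w "{w}"] by (auto simp: L_def)
  have "span {w} \<noteq> {0}" using w(2) span_base[of w "{w}"] by auto
  moreover have "span {w} \<noteq> UNIV"
  proof
    assume "span {w} = UNIV"
    then have "dimension = 1" using dim1 dim_UNIV unfolding dimension_def by metis
    then show False using dim3 by simp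
  qed
  ultimately have "span {w} \<in> verts (subspace_sum_graph scale) - D"
    using wD by (simp add: subspace_sum_graph_def)
  then obtain U where "U \<in> D" "adj (subspace_sum_graph scale) (span {w}) U"
    using D(1) unfolding dominating_set_def by blast
  then have U: "U \<in> D" "span {w} + U = UNIV"
    by (simp_all add: subspace_sum_graph_def)
  show False
  proof (cases "U \<in> L")
    case True
    have "dim (span {w} + U) \<le> 2"
      using dim_plus_Int[of "span {w}" U] vert(1)[OF U(1)] dim1 True by (auto simp: L_def)
    then show False using U(2) dim3 by (simp add: dimension_def)
  next
    case False
    have "span {w} \<subseteq> X" using w(1) X(1) by (simp add: span_minimal)
    then have "span {w} + U \<subseteq> X + U" by (intro set_plus_mono2) auto
    then show False using U X(3) False by (auto simp: M_def)
  qed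
qed

end

section \<open>The domination number\<close>

text \<open>
  Only finite competitors have to be compared: a finite set injects into every infinite one, and
  infinite dominating sets contribute \<open>\<infinity>\<close> to the infimum.
\<close>

lemma minimum_dominating_set_if_card_le:
  assumes "dominating_set G D" "finite D"
    and le: "\<And>D'. dominating_set G D' \<Longrightarrow> finite D' \<Longrightarrow> card D \<le> card D'"
  shows "minimum_dominating_set G D" and "domination_number G = enat (card D)"
proof -
  have "D \<lesssim> D'" if "dominating_set G D'" for D'
    using that le[of D'] assms(2) finite_lepoll_infinite[of D' D] lepoll_iff_card_le[of D D']
    by blast
  then show "minimum_dominating_set G D"
    using assms(1) by (simp add: minimum_dominating_set_def)
  show "domination_number G = enat (card D)"
  proof (rule antisym)
    have "domination_number G \<le> (if finite D then enat (card D) else \<infinity>)"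
      unfolding domination_number_def using assms(1) by (intro INF_lower) simp
    then show "domination_number G \<le> enat (card D)" using assms(2) by simp
    show "enat (card D) \<le> domination_number G"
      unfolding domination_number_def using le by (intro INF_greatest) auto
  qed
qed

theorem theorem5p1:
  fixes scale :: "'f::field \<Rightarrow> 'v::ab_group_add \<Rightarrow> 'v"
    and n :: nat and \<alpha> :: "nat \<Rightarrow> 'v"
  assumes "vector_space scale"
    and "vector_space.dim scale (UNIV :: 'v set) = n"
    and "n > 1"
    and "inj_on \<alpha> {1..n}"
    and "\<not> module.dependent scale (\<alpha> ` {1..n})"
    and "module.span scale (\<alpha> ` {1..n}) = UNIV"
  shows "dominating_set (subspace_sum_graph scale) (basis_hyperplanes scale n \<alpha>) \<and>
    (n \<noteq> 2 \<longrightarrow>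
      minimum_dominating_set (subspace_sum_graph scale) (basis_hyperplanes scale n \<alpha>) \<and>
      domination_number (subspace_sum_graph scale) = enat n)"
proof -
  interpret vector_space scale by (rule assms(1))
  interpret indexed_basis scale n \<alpha>
    using assms(4-6) by unfold_locales
  interpret finite_dimensional_vector_space scale "\<alpha> ` {1..n}"
    using indep spanning by unfold_locales auto
  have dimension: "dimension = n"
    unfolding dimension_def using card_image[OF inj] by simp
  note dom = dominating_basis_hyperplanes[OF assms(3)]
  have fin: "finite (basis_hyperplanes scale n \<alpha>)"
    by (simp add: basis_hyperplanes_def)
  have le: "card (basis_hyperplanes scale n \<alpha>) \<le> card D"
    if "n \<noteq> 2" "dominating_set (subspace_sum_graph scale) D" "finite D" for D
    using dimension_le_card_dominating_set[of D] that assms(3)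
    unfolding dimension card_basis_hyperplanes by simp
  show ?thesis
    using dom minimum_dominating_set_if_card_le[OF dom fin le]
    by (simp add: card_basis_hyperplanes)
qed

end
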